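(* Let $q$ be an odd prime, $d\ge1$, and $Y:=\mathbb{F}_q^d\setminus\{0\}$. For $E\subseteq\mathbb{F}_q^d$ with $1<\sharp E<q^d$ write $E^*:=E\setminus\{0\}$. (Direct part.) Suppose $E$ has a spectrum $L\subseteq\mathbb{F}_q^d$ and $E^*\neq\emptyset$ is a multiplicative tiling set with respect to $\mathcal{A}^t=\{a^t: a\in\mathcal{A}\}$ for some $\mathcal{A}\subseteq\mathrm{Aut}(\mathbb{F}_q^d)$. Let $\psi:=(\sharp E)^{-1/2}\,\check{1_{E^*}}$. Then the family $\mathcal{W}:=\{\delta_a\tau_l\psi: a\in\mathcal{A},\ l\in L\}$ is a Parseval frame for $PW_Y$. The system $\mathcal{W}$ is an orthonormal basis for $PW_Y$ if $E=E^*$. (Converse part.) Conversely, let $\mathcal{A}\subseteq\mathrm{Aut}(\mathbb{F}_q^d)$ and $L\subseteq\mathbb{F}_q^d$, and suppose that $\psi=(\sharp E)^{-1/2}\,\check{1_E}$ is a Parseval wavelet for $PW_Y$ with respect to the dilation set $\mathcal{A}$ and the translation set $L$, i.e. $\{\delta_a\tau_l\psi: a\in\mathcal{A},\ l\in L\}$ is a Parseval frame for $PW_Y$. Then $Y=\bigcup_{a\in\mathcal{A}}a^t(E^* )$. If moreover the sets $a^t(E^* )$, $a\in\mathcal{A}$, are pairwise disjoint, then $(E^*,L)$ is a tight frame spectral pair.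
   Context: $\mathbb{F}_q$ is the field with $q$ elements; $\mathrm{Aut}(\mathbb{F}_q^d)$ is the set of automorphisms of $\mathbb{F}_q^d$, identified with invertible $d\times d$ matrices; $a^t$ is the transpose of $a$. For $m,x\in\mathbb{F}_q^d$, $\chi_m(x)=e^{2\pi i\, m\cdot x/q}$. Fourier transform: $\hat f(\xi)=q^{-d}\sum_{m} f(m)\overline{\chi_m(\xi)}$; inverse: $\check g(x)=\sum_{m} g(m)\chi_m(x)$. The inner product on the space $L^2(\mathbb{F}_q^d)$ on which wavelet systems live is $\langle f,g\rangle=q^{-d}\sum_x f(x)\overline{g(x)}$, while on the Fourier side, and on $L^2(F)$ for $F\subseteq\mathbb{F}_q^d$ on the Fourier side, it is $\sum_m f(m)\overline{g(m)}$; thus $f\mapsto\hat f$ is unitary. $\delta_a\psi(x)=\psi(ax)$, $\tau_t\psi(x)=\psi(x-t)$, so $\delta_a\tau_t\psi(x)=\psi(ax-t)$. The Paley-Wiener space of $F\subseteq\mathbb{F}_q^d$ is $PW_F=\{f\in L^2(\mathbb{F}_q^d): \hat f(m)=0\ \text{for all } m\notin F\}$. $E$ has spectrum $L$ (equivalently $(E,L)$ is a spectral pair) if $\{\chi_l\}_{l\in L}$, restricted to $E$, is an orthogonal basis of $L^2(E)$ (equivalently, $\{(\sharp E)^{-1/2}\chi_l\}_{l\in L}$ is an orthonormal basis of $L^2(E)$ for counting measure). $(E,L)$ is a tight frame spectral pair if $\{\chi_l:l\in L\}$ is a tight frame for $L^2(E)$. A set $G$ is a multiplicative tiling set with respect to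 a set $\mathcal{B}$ of automorphisms if $Y=\bigcup_{\alpha\in\mathcal{B}}\alpha(G)$ as a disjoint union. A family $\{x_k\}_{k\in I}$ of elements of a Hilbert space $\mathcal{H}$ is a tight frame with frame bound $A>0$ if $\sum_k|\langle x,x_k\rangle|^2=A\|x\|^2$ for all $x\in\mathcal{H}$, and a Parseval frame if $A=1$. Families are indexed by pairs $(a,l)$. *)

theory Defs
  imports
    "HOL-Analysis.Analysis"
    "HOL-Library.Disjoint_Sets"
    "HOL-Library.Function_Algebras"
    "Berlekamp_Zassenhaus.Finite_Field"
begin

text \<open>
  For a type \<open>'q\<close> of class \<open>prime_card\<close>, the type \<open>'q mod_ring\<close> is the prime field with
  \<open>CARD('q)\<close> elements, and \<open>'q mod_ring ^ 'd\<close> is its \<open>CARD('d)\<close>-dimensional coordinate space.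
\<close>

definition Aut_mat :: "('q::prime_card mod_ring ^ 'd ^ 'd) set"
  where "Aut_mat = {a. invertible a}"

definition chi :: "'q::prime_card mod_ring ^ 'd \<Rightarrow> 'q mod_ring ^ 'd \<Rightarrow> complex"
  where "chi m x =
    exp (2 * complex_of_real pi * \<i> * of_int (to_int_mod_ring (scalar_product m x)) / of_nat CARD('q))"

definition fourier ::
    "('q::prime_card mod_ring ^ 'd \<Rightarrow> complex) \<Rightarrow> 'q mod_ring ^ 'd \<Rightarrow> complex"
  where "fourier f \<xi> = (\<Sum>m\<in>UNIV. f m * cnj (chi m \<xi>)) / of_nat (CARD('q) ^ CARD('d))"

definition inv_fourier ::
    "('q::prime_card mod_ring ^ 'd \<Rightarrow> complex) \<Rightarrow> 'q mod_ring ^ 'd \<Rightarrow> complex"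
  where "inv_fourier g x = (\<Sum>m\<in>UNIV. g m * chi m x)"

definition dilate ::
    "'q::prime_card mod_ring ^ 'd ^ 'd \<Rightarrow> ('q mod_ring ^ 'd \<Rightarrow> complex) \<Rightarrow> 'q mod_ring ^ 'd \<Rightarrow> complex"
  where "dilate a f x = f (a *v x)"

definition translate ::
    "'q::prime_card mod_ring ^ 'd \<Rightarrow> ('q mod_ring ^ 'd \<Rightarrow> complex) \<Rightarrow> 'q mod_ring ^ 'd \<Rightarrow> complex"
  where "translate t f x = f (x - t)"

text \<open>The normalized inner product (wavelet side) and the counting inner product (Fourier side).\<close>

definition space_ip ::
    "('q::prime_card mod_ring ^ 'd \<Rightarrow> complex) \<Rightarrow> ('q mod_ring ^ 'd \<Rightarrow> complex) \<Rightarrow> complex"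
  where "space_ip f g = (\<Sum>x\<in>UNIV. f x * cnj (g x)) / of_nat (CARD('q) ^ CARD('d))"

definition freq_ip ::
    "('q::prime_card mod_ring ^ 'd \<Rightarrow> complex) \<Rightarrow> ('q mod_ring ^ 'd \<Rightarrow> complex) \<Rightarrow> complex"
  where "freq_ip f g = (\<Sum>m\<in>UNIV. f m * cnj (g m))"

definition PW :: "('q::prime_card mod_ring ^ 'd) set \<Rightarrow> ('q mod_ring ^ 'd \<Rightarrow> complex) set"
  where "PW F = {f. \<forall>m. m \<notin> F \<longrightarrow> fourier f m = 0}"

text \<open>
  Functions on \<open>F\<close> are represented by their extensions by zero, so that the inner product of
  \<open>L2 F\<close> is the restriction of \<^const>\<open>freq_ip\<close>.
\<close>

definition L2 :: "('q::prime_card mod_ring ^ 'd) set \<Rightarrow> ('q mod_ring ^ 'd \<Rightarrow> complex) set"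
  where "L2 F = {f. \<forall>x. x \<notin> F \<longrightarrow> f x = 0}"

definition chi_on ::
    "('q::prime_card mod_ring ^ 'd) set \<Rightarrow> 'q mod_ring ^ 'd \<Rightarrow> 'q mod_ring ^ 'd \<Rightarrow> complex"
  where "chi_on F l x = (if x \<in> F then chi l x else 0)"

definition cscale :: "complex \<Rightarrow> ('x \<Rightarrow> complex) \<Rightarrow> 'x \<Rightarrow> complex"
  where "cscale c f x = c * f x"

interpretation cfun: vector_space cscale
  by unfold_locales (simp_all add: cscale_def fun_eq_iff algebra_simps)

text \<open>
  Below, a Hilbert space is given by its carrier \<open>H\<close> and an inner product \<open>ip\<close>.  The function
  spaces in question are finite-dimensional, so algebraic spans are closed.  Families are indexed:
  a repeated vector counts with its multiplicity, and a basis has no repetitions.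
\<close>

definition tight_frame ::
    "('v \<Rightarrow> 'v \<Rightarrow> complex) \<Rightarrow> 'v set \<Rightarrow> real \<Rightarrow> 'i::finite set \<Rightarrow> ('i \<Rightarrow> 'v) \<Rightarrow> bool"
  where "tight_frame ip H A I u \<longleftrightarrow>
    A > 0 \<and> (\<forall>k\<in>I. u k \<in> H) \<and>
    (\<forall>f\<in>H. (\<Sum>k\<in>I. (cmod (ip f (u k)))\<^sup>2) = A * Re (ip f f))"

definition parseval_frame ::
    "('v \<Rightarrow> 'v \<Rightarrow> complex) \<Rightarrow> 'v set \<Rightarrow> 'i::finite set \<Rightarrow> ('i \<Rightarrow> 'v) \<Rightarrow> bool"
  where "parseval_frame ip H I u \<longleftrightarrow> tight_frame ip H 1 I u"

definition basis_family :: "('x \<Rightarrow> complex) set \<Rightarrow> 'i set \<Rightarrow> ('i \<Rightarrow> 'x \<Rightarrow> complex) \<Rightarrow> bool"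
  where "basis_family H I u \<longleftrightarrow>
    inj_on u I \<and> cfun.independent (u ` I) \<and> cfun.span (u ` I) = H"

definition orthogonal_basis ::
    "(('x \<Rightarrow> complex) \<Rightarrow> ('x \<Rightarrow> complex) \<Rightarrow> complex) \<Rightarrow> ('x \<Rightarrow> complex) set \<Rightarrow>
      'i set \<Rightarrow> ('i \<Rightarrow> 'x \<Rightarrow> complex) \<Rightarrow> bool"
  where "orthogonal_basis ip H I u \<longleftrightarrow>
    basis_family H I u \<and> (\<forall>j\<in>I. \<forall>k\<in>I. j \<noteq> k \<longrightarrow> ip (u j) (u k) = 0)"

definition orthonormal_basis ::
    "(('x \<Rightarrow> complex) \<Rightarrow> ('x \<Rightarrow> complex) \<Rightarrow> complex) \<Rightarrow> ('x \<Rightarrow> complex) set \<Rightarrow>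
      'i set \<Rightarrow> ('i \<Rightarrow> 'x \<Rightarrow> complex) \<Rightarrow> bool"
  where "orthonormal_basis ip H I u \<longleftrightarrow>
    orthogonal_basis ip H I u \<and> (\<forall>k\<in>I. ip (u k) (u k) = 1)"

definition spectral_pair ::
    "('q::prime_card mod_ring ^ 'd) set \<Rightarrow> ('q mod_ring ^ 'd) set \<Rightarrow> bool"
  where "spectral_pair E L \<longleftrightarrow> orthogonal_basis freq_ip (L2 E) L (chi_on E)"

definition tight_frame_spectral_pair ::
    "('q::prime_card mod_ring ^ 'd) set \<Rightarrow> ('q mod_ring ^ 'd) set \<Rightarrow> bool"
  where "tight_frame_spectral_pair E L \<longleftrightarrow> (\<exists>A. tight_frame freq_ip (L2 E) A L (chi_on E))"

definition mult_tiling ::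
    "('q::prime_card mod_ring ^ 'd) set \<Rightarrow> ('q mod_ring ^ 'd) set \<Rightarrow>
      ('q mod_ring ^ 'd ^ 'd) set \<Rightarrow> bool"
  where "mult_tiling Y G B \<longleftrightarrow>
    Y = (\<Union>\<alpha>\<in>B. (*v) \<alpha> ` G) \<and> disjoint_family_on (\<lambda>\<alpha>. (*v) \<alpha> ` G) B"

text \<open>The wavelet family is indexed by the pairs \<open>(a, l)\<close>.\<close>

definition wavelet_system ::
    "('q::prime_card mod_ring ^ 'd \<Rightarrow> complex) \<Rightarrow>
      ('q mod_ring ^ 'd ^ 'd) \<times> ('q mod_ring ^ 'd) \<Rightarrow> 'q mod_ring ^ 'd \<Rightarrow> complex"
  where "wavelet_system \<psi> = (\<lambda>(a, l). dilate a (translate l \<psi>))"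

text \<open>\<open>wavelet_of F E\<close> is the inverse Fourier transform of \<open>1\<^sub>F\<close>, divided by \<open>\<surd>(\<sharp>E)\<close>.\<close>

definition wavelet_of ::
    "('q::prime_card mod_ring ^ 'd) set \<Rightarrow> ('q mod_ring ^ 'd) set \<Rightarrow> 'q mod_ring ^ 'd \<Rightarrow> complex"
  where "wavelet_of F E x = inv_fourier (indicator F) x / complex_of_real (sqrt (real (card E)))"

end

theory Submission
  imports Defs
begin

text \<open>
  Expand a wavelet in characters: \<open>\<delta>\<^sub>a \<tau>\<^sub>l \<psi>\<close> is the combination of the \<open>\<chi>\<close> indexed by
  \<open>a\<^sup>t m\<close>, \<open>m \<in> F\<close>, with coefficients \<open>\<chi>\<^sub>l(m)\<close> conjugated and divided by \<open>\<surd>(\<sharp>E)\<close>.  Hence the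
  wavelet coefficient of \<open>f\<close> at \<open>(a, l)\<close> is
  \<open>(\<Sum>m\<in>F. f\<^sup>^(a\<^sup>t m) \<chi>\<^sub>l(m)) / \<surd>(\<sharp>E)\<close>, where \<open>f\<^sup>^\<close> is the Fourier transform
  (\<open>wavelet_coefficient\<close>).  Up to conjugation this is an inner product, over the frequency set
  \<open>F\<close>, of the piece of \<open>f\<^sup>^\<close> living on \<open>a\<^sup>t F\<close> with the character \<open>\<chi>\<^sub>l\<close>
  (\<open>freq_ip_chi_on\<close>).  The dilations therefore
  cut frequency space into pieces and the translations analyse each piece separately; both
  directions of the theorem follow from this.

  For the direct part, the spectral property of \<open>E\<close> makes \<open>{\<chi>\<^sub>l}\<close> a tight frame with bound \<open>\<sharp>E\<close>
  on every piece, the bound cancels the normalization of \<open>\<psi>\<close>, and the tiling together with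
  Plancherel's identity adds the energies of the pieces up to the norm of \<open>f\<close>
  (\<open>spectral_tiling_parseval\<close>).  When \<open>0 \<notin> E\<close> the wavelets moreover have norm one, and a Parseval
  frame of unit vectors is an orthonormal basis
  (\<open>inner_space.parseval_unit_orthonormal_basis\<close>).

  For the converse, membership of the wavelets in the Paley-Wiener space excludes \<open>0\<close> from \<open>E\<close>.
  A nonzero frequency \<open>\<xi>\<close> outside all sets \<open>a\<^sup>t E\<close> would make the character \<open>\<chi>\<^sub>\<xi>\<close> orthogonal to the
  whole system (\<open>parseval_covers\<close>).  If the sets \<open>a\<^sup>t E\<close> are disjoint, a function on \<open>E\<close> can be moved
  to a single piece \<open>a\<^sup>t E\<close>, where only the translates belonging to that \<open>a\<close> see it; the Parseval
  identity then reduces to the tight frame identity on \<open>E\<close>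
  (\<open>parseval_disjoint_tight_frame\<close>).
\<close>

section \<open>Frames and bases in spaces of complex functions\<close>

text \<open>
  The normalized and the counting inner product share the following axioms, so the linear algebra
  below serves both.
\<close>

locale inner_space =
  fixes ip :: "('x \<Rightarrow> complex) \<Rightarrow> ('x \<Rightarrow> complex) \<Rightarrow> complex"
  assumes ip_add: "ip (f + g) h = ip f h + ip g h"
    and ip_scale: "ip (cscale c f) h = c * ip f h"
    and ip_cnj: "cnj (ip f g) = ip g f"
    and ip_definite: "ip f f = 0 \<Longrightarrow> f = 0"
begin

lemma ip_zero: "ip 0 h = 0"
  using ip_add[of 0 0 h] by simp

lemma ip_sum_left: "ip (\<Sum>k\<in>I. cscale (c k) (u k)) h = (\<Sum>k\<in>I. c k * ip (u k) h)"
  by (induction I rule: infinite_finite_induct)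
    (simp_all only: sum.infinite sum.empty sum.insert ip_zero ip_add ip_scale not_False_eq_True)

lemma ip_sum_right: "ip h (\<Sum>k\<in>I. cscale (c k) (u k)) = (\<Sum>k\<in>I. cnj (c k) * ip h (u k))"
proof -
  have "ip h (\<Sum>k\<in>I. cscale (c k) (u k)) = cnj (ip (\<Sum>k\<in>I. cscale (c k) (u k)) h)"
    by (simp add: ip_cnj)
  then show ?thesis
    by (simp add: ip_sum_left ip_cnj)
qed

lemma ip_self_real: "ip f f = of_real (Re (ip f f))"
proof -
  have "Im (ip f f) = 0"
    using arg_cong[OF ip_cnj[of f f], of Im] by simp
  then show ?thesis
    by (simp add: complex_eq_iff)
qed

text \<open>
  Orthogonality reads off the expansion coefficients of \<open>f\<close> as \<open>ip f (u\<^sub>k) / A\<close>; both sides of the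
  frame identity are then \<open>A\<^sup>2\<close> times the sum of their squared moduli.
\<close>

lemma orthogonal_basis_tight_frame:
  fixes u :: "'i::finite \<Rightarrow> 'x \<Rightarrow> complex"
  assumes basis: "orthogonal_basis ip H I u"
    and norm: "\<And>k. k \<in> I \<Longrightarrow> ip (u k) (u k) = of_real A"
    and "A > 0"
  shows "tight_frame ip H A I u"
proof -
  have inj: "inj_on u I" and span: "cfun.span (u ` I) = H"
    and orth: "\<And>j k. j \<in> I \<Longrightarrow> k \<in> I \<Longrightarrow> j \<noteq> k \<Longrightarrow> ip (u j) (u k) = 0"
    using basis by (auto simp: orthogonal_basis_def basis_family_def)
  have "(\<Sum>k\<in>I. (cmod (ip f (u k)))\<^sup>2) = A * Re (ip f f)" if "f \<in> H" for f
  proof -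
    have "f \<in> range (\<lambda>c. \<Sum>v\<in>u ` I. cscale (c v) v)"
      using that cfun.span_finite[of "u ` I"] span by simp
    then obtain c where "f = (\<Sum>v\<in>u ` I. cscale (c v) v)"
      by auto
    then have f: "f = (\<Sum>k\<in>I. cscale (c (u k)) (u k))"
      using inj by (simp add: sum.reindex)
    have coeff: "ip f (u k) = c (u k) * A" if "k \<in> I" for k
    proof -
      have "ip f (u k) = (\<Sum>j\<in>I. c (u j) * ip (u j) (u k))"
        by (subst f) (rule ip_sum_left)
      also have "\<dots> = (\<Sum>j\<in>I. if j = k then c (u k) * A else 0)"
        using that by (intro sum.cong) (auto simp: norm orth)
      finally show ?thesis
        using that by simp
    qed
    have "ip f f = (\<Sum>k\<in>I. c (u k) * ip (u k) f)"
      by (subst (1) f) (rule ip_sum_left)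
    also have "\<dots> = (\<Sum>k\<in>I. c (u k) * cnj (ip f (u k)))"
      by (simp add: ip_cnj)
    also have "\<dots> = (\<Sum>k\<in>I. of_real (A * (cmod (c (u k)))\<^sup>2))"
      by (intro sum.cong) (simp_all add: coeff complex_norm_square[symmetric] mult_ac
          flip: of_real_power)
    finally have "Re (ip f f) = (\<Sum>k\<in>I. A * (cmod (c (u k)))\<^sup>2)"
      by simp
    moreover have "(\<Sum>k\<in>I. (cmod (ip f (u k)))\<^sup>2) = (\<Sum>k\<in>I. A * (A * (cmod (c (u k)))\<^sup>2))"
      by (intro sum.cong) (simp_all add: coeff norm_mult power_mult_distrib power2_eq_square)
    ultimately show ?thesis
      by (simp add: sum_distrib_left)
  qed
  moreover have "u k \<in> H" if "k \<in> I" for k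
    using that span cfun.span_base by blast
  ultimately show ?thesis
    using \<open>A > 0\<close> by (simp add: tight_frame_def)
qed

text \<open>
  Applied to a member \<open>u\<^sub>j\<close>, the Parseval identity has the term \<open>1\<close> for \<open>j\<close> itself and total \<open>1\<close>,
  so all other terms vanish and the family is orthonormal.  It spans because the
  residual of the expansion of \<open>f\<close> is orthogonal to every member, hence has norm zero by the
  Parseval identity again.
\<close>

lemma parseval_unit_orthonormal_basis:
  fixes u :: "'i::finite \<Rightarrow> 'x \<Rightarrow> complex"
  assumes frame: "parseval_frame ip H I u"
    and unit: "\<And>k. k \<in> I \<Longrightarrow> ip (u k) (u k) = 1"
    and sub: "cfun.subspace H"
  shows "orthonormal_basis ip H I u"
proof -
  have mem: "\<And>k. k \<in> I \<Longrightarrow> u k \<in> H"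
    and pars: "\<And>f. f \<in> H \<Longrightarrow> (\<Sum>k\<in>I. (cmod (ip f (u k)))\<^sup>2) = Re (ip f f)"
    using frame by (auto simp: parseval_frame_def tight_frame_def)
  have orth: "ip (u j) (u k) = 0" if "j \<in> I" "k \<in> I" "j \<noteq> k" for j k
  proof -
    have "1 + (\<Sum>i\<in>I - {j}. (cmod (ip (u j) (u i)))\<^sup>2) = 1"
      using pars[OF mem[OF that(1)]] that(1) by (simp add: sum.remove unit)
    then show ?thesis
      using that by (simp add: sum_nonneg_eq_0_iff)
  qed
  have inj: "inj_on u I"
    using orth unit by (metis inj_onI zero_neq_one)
  have coeff: "ip (\<Sum>k\<in>I. cscale (c k) (u k)) (u j) = c j" if "j \<in> I" for c j
  proof -
    have "ip (\<Sum>k\<in>I. cscale (c k) (u k)) (u j) = (\<Sum>k\<in>I. if k = j then c j else 0)"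
      unfolding ip_sum_left using that by (intro sum.cong) (auto simp: unit orth)
    then show ?thesis
      using that by simp
  qed
  have "cfun.independent (u ` I)"
  proof
    assume "cfun.dependent (u ` I)"
    then obtain c v where v: "v \<in> u ` I" "c v \<noteq> 0" and "(\<Sum>v\<in>u ` I. cscale (c v) v) = 0"
      using cfun.dependent_finite[of "u ` I"] by auto
    then have "(\<Sum>k\<in>I. cscale (c (u k)) (u k)) = 0"
      using inj by (simp add: sum.reindex)
    then show False
      using v coeff[of _ "\<lambda>k. c (u k)"] by (auto simp: ip_zero)
  qed
  moreover have "H \<subseteq> cfun.span (u ` I)"
  proof
    fix f assume f: "f \<in> H"
    define p where "p = (\<Sum>k\<in>I. cscale (ip f (u k)) (u k))"
    have p: "p \<in> cfun.span (u ` I)"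
      unfolding p_def by (intro cfun.span_sum cfun.span_scale cfun.span_base) auto
    have "cfun.span (u ` I) \<subseteq> H"
      using mem sub by (intro cfun.span_minimal) auto
    then have r: "f - p \<in> H"
      using f p sub by (intro cfun.subspace_diff) auto
    have "ip (f - p) (u j) = 0" if "j \<in> I" for j
    proof -
      have "ip f (u j) = ip (f - p) (u j) + ip p (u j)"
        using ip_add[of "f - p" p] by simp
      then show ?thesis
        using coeff[OF that] by (simp add: p_def)
    qed
    then have "Re (ip (f - p) (f - p)) = 0"
      using pars[OF r] by simp
    then have "f - p = 0"
      using ip_definite ip_self_real by (metis of_real_0)
    then show "f \<in> cfun.span (u ` I)"
      using p by simp
  qed
  moreover have "cfun.span (u ` I) \<subseteq> H"
    using mem sub by (intro cfun.span_minimal) auto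
  ultimately show ?thesis
    using inj orth unit by (auto simp: orthonormal_basis_def orthogonal_basis_def basis_family_def)
qed

end

lemma sum_cnj_self_zero:
  fixes f :: "'x::finite \<Rightarrow> complex"
  assumes "(\<Sum>x\<in>UNIV. f x * cnj (f x)) = 0"
  shows "f = 0"
proof -
  have "of_real (\<Sum>x\<in>UNIV. (cmod (f x))\<^sup>2) = (0::complex)"
    using assms by (simp add: complex_norm_square del: of_real_power)
  then have "(\<Sum>x\<in>UNIV. (cmod (f x))\<^sup>2) = 0"
    using of_real_eq_0_iff by blast
  then show ?thesis
    by (simp add: sum_nonneg_eq_0_iff fun_eq_iff)
qed

interpretation freq: inner_space freq_ip
proof
  show "freq_ip (f + g) h = freq_ip f h + freq_ip g h" for f g h :: "'q::prime_card mod_ring ^ 'd \<Rightarrow> complex"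
    by (simp add: freq_ip_def distrib_right sum.distrib)
  show "freq_ip (cscale c f) h = c * freq_ip f h" for c and f h :: "'q::prime_card mod_ring ^ 'd \<Rightarrow> complex"
    by (simp add: freq_ip_def cscale_def sum_distrib_left mult.assoc)
  show "cnj (freq_ip f g) = freq_ip g f" for f g :: "'q::prime_card mod_ring ^ 'd \<Rightarrow> complex"
    by (simp add: freq_ip_def mult.commute)
  show "f = 0" if "freq_ip f f = 0" for f :: "'q::prime_card mod_ring ^ 'd \<Rightarrow> complex"
    using that unfolding freq_ip_def by (rule sum_cnj_self_zero)
qed

lemma space_ip_eq_freq_ip: "space_ip f g = freq_ip f g / of_nat (CARD('q) ^ CARD('d))"
  for f g :: "'q::prime_card mod_ring ^ 'd \<Rightarrow> complex"
  by (simp add: space_ip_def freq_ip_def)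

interpretation space: inner_space space_ip
proof
  show "space_ip (f + g) h = space_ip f h + space_ip g h" for f g h :: "'q::prime_card mod_ring ^ 'd \<Rightarrow> complex"
    by (simp only: space_ip_eq_freq_ip freq.ip_add add_divide_distrib)
  show "space_ip (cscale c f) h = c * space_ip f h" for c and f h :: "'q::prime_card mod_ring ^ 'd \<Rightarrow> complex"
    by (simp only: space_ip_eq_freq_ip freq.ip_scale times_divide_eq_right)
  show "cnj (space_ip f g) = space_ip g f" for f g :: "'q::prime_card mod_ring ^ 'd \<Rightarrow> complex"
    by (simp add: space_ip_eq_freq_ip freq.ip_cnj)
  show "f = 0" if "space_ip f f = 0" for f :: "'q::prime_card mod_ring ^ 'd \<Rightarrow> complex"
    using that by (intro freq.ip_definite) (simp add: space_ip_eq_freq_ip)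
qed

section \<open>Characters and the Fourier transform\<close>

text \<open>
  The exponential of the integer representative depends only on the residue class, hence turns
  modular addition into multiplication.
\<close>

lemma exp_mod_ring_add:
  fixes x y :: "'q::prime_card mod_ring"
  defines "e \<equiv> \<lambda>z::'q mod_ring.
    exp (2 * complex_of_real pi * \<i> * of_int (to_int_mod_ring z) / of_nat CARD('q))"
  shows "e (x + y) = e x * e y"
proof -
  define q where "q = int CARD('q)"
  define s where "s = to_int_mod_ring x + to_int_mod_ring y"
  have q0: "of_int q \<noteq> (0::complex)" "of_nat CARD('q) = (of_int q :: complex)"
    by (auto simp: q_def)
  have split: "of_int s = of_int (s mod q) + of_int q * (of_int (s div q) :: complex)"
    by (metis of_int_add of_int_mult add.commute mult_div_mod_eq)
  have "e x * e y = exp (2 * complex_of_real pi * \<i> * of_int s / of_int q)"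
    unfolding e_def q0(2) s_def by (simp add: exp_add[symmetric] add_divide_distrib ring_distribs)
  also have "2 * complex_of_real pi * \<i> * of_int s / of_int q =
      2 * complex_of_real pi * \<i> * of_int (s mod q) / of_int q +
      \<i> * (of_int (s div q) * (of_real pi * 2))"
    using q0(1) unfolding split by (simp add: field_simps)
  also have "exp \<dots> = e (x + y)"
    unfolding exp_add exp_2pi_1_int e_def q0(2) by (simp add: to_int_mod_ring_add s_def q_def)
  finally show ?thesis by simp
qed

lemma scalar_product_commute:
  fixes x y :: "'a::comm_semiring_1 ^ 'd"
  shows "scalar_product x y = scalar_product y x"
  by (simp add: scalar_product_def mult.commute)

lemma scalar_product_transpose:
  fixes a :: "'a::comm_semiring_1 ^ 'd ^ 'e"
  shows "scalar_product m (a *v x) = scalar_product (transpose a *v m) x"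
proof -
  have "scalar_product m (a *v x) = (\<Sum>i\<in>UNIV. \<Sum>j\<in>UNIV. m $ i * (a $ i $ j * x $ j))"
    by (simp add: scalar_product_def matrix_vector_mult_def sum_distrib_left)
  also have "\<dots> = (\<Sum>j\<in>UNIV. \<Sum>i\<in>UNIV. m $ i * (a $ i $ j * x $ j))"
    by (rule sum.swap)
  also have "\<dots> = scalar_product (transpose a *v m) x"
    by (simp add: scalar_product_def matrix_vector_mult_def transpose_def sum_distrib_left
        sum_distrib_right mult_ac)
  finally show ?thesis .
qed

lemma chi_commute: "chi m x = chi x m"
  by (simp add: chi_def scalar_product_commute)

lemma chi_transpose: "chi m (a *v x) = chi (transpose a *v m) x"
  by (simp add: chi_def scalar_product_transpose)

lemma chi_add: "chi m (x + y) = chi m x * chi m y"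
proof -
  have "scalar_product m (x + y) = scalar_product m x + scalar_product m y"
    by (simp add: scalar_product_def distrib_left sum.distrib)
  then show ?thesis
    by (simp add: chi_def exp_mod_ring_add)
qed

lemma chi_cnj_self: "chi m x * cnj (chi m x) = 1"
proof -
  have "cmod (chi m x) = 1"
    unfolding chi_def norm_exp_eq_Re by simp
  then show ?thesis
    by (simp add: complex_norm_square[symmetric])
qed

lemma chi_zero: "chi m 0 = 1"
  by (simp add: chi_def scalar_product_def)

lemma chi_minus: "chi m (- x) = cnj (chi m x)"
proof -
  have "chi m x * chi m (- x) = chi m x * cnj (chi m x)"
    using chi_add[of m x "- x"] by (simp add: chi_cnj_self chi_zero)
  moreover have "chi m x \<noteq> 0"
    by (simp add: chi_def)
  ultimately show ?thesis by simp
qed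

lemma chi_diff: "chi m (x - y) = chi m x * cnj (chi m y)"
  using chi_add[of m x "- y"] by (simp add: chi_minus)

lemma chi_nontrivial:
  fixes m :: "'q::prime_card mod_ring ^ 'd"
  assumes "m \<noteq> 0"
  obtains y where "chi m y \<noteq> 1"
proof -
  obtain i where i: "m $ i \<noteq> 0"
    using assms by (auto simp: vec_eq_iff)
  define t where "t = to_int_mod_ring (m $ i)"
  have "t \<in> {0..<int CARD('q)}"
    using range_to_int_mod_ring[where 'a='q] unfolding t_def by blast
  moreover have "t \<noteq> 0"
    using i unfolding t_def by simp
  ultimately have t: "0 < t" "t < int CARD('q)" by auto
  have "scalar_product m (axis i 1) = m $ i"
    by (simp add: scalar_product_def axis_def if_distrib cong: if_cong)
  then have chi: "chi m (axis i 1) = exp (2 * complex_of_real pi * \<i> * of_int t / of_nat CARD('q))"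
    by (simp add: chi_def t_def)
  have "chi m (axis i 1) \<noteq> 1"
  proof
    assume "chi m (axis i 1) = 1"
    then obtain n :: int where "2 * pi * t / CARD('q) = of_int (2 * n) * pi"
      unfolding chi exp_eq_1 by auto
    then have "real_of_int t = of_int (n * int CARD('q))"
      by (simp add: field_simps)
    then have "t = n * int CARD('q)"
      by linarith
    then have "int CARD('q) dvd t" by simp
    then show False
      using t zdvd_not_zless by blast
  qed
  then show ?thesis
    by (rule that)
qed

lemma sum_chi:
  fixes m :: "'q::prime_card mod_ring ^ 'd"
  shows "(\<Sum>x\<in>UNIV. chi m x) = (if m = 0 then of_nat (CARD('q) ^ CARD('d)) else 0)"
proof (cases "m = 0")
  case True
  then show ?thesis
    by (simp add: chi_commute[of 0] chi_zero)
next
  case False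
  then obtain y where y: "chi m y \<noteq> 1"
    by (rule chi_nontrivial)
  \<comment> \<open>Translating by \<open>y\<close> permutes the summands and multiplies the sum by \<open>\<chi>\<^sub>m(y) \<noteq> 1\<close>.\<close>
  have "(\<Sum>x\<in>UNIV. chi m x) = (\<Sum>x\<in>UNIV. chi m (y + x))"
    by (rule sum.reindex_bij_betw[symmetric]) (simp add: bij_plus_right)
  also have "\<dots> = chi m y * (\<Sum>x\<in>UNIV. chi m x)"
    by (simp add: chi_add sum_distrib_left)
  finally show ?thesis
    using y False by simp
qed

lemma sum_chi_cnj:
  fixes m n :: "'q::prime_card mod_ring ^ 'd"
  shows "(\<Sum>x\<in>UNIV. chi x m * cnj (chi x n)) = (if m = n then of_nat (CARD('q) ^ CARD('d)) else 0)"
  using sum_chi[of "m - n"] by (simp add: chi_commute[of "m - n"] chi_diff)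

lemma fourier_eq_space_ip: "fourier f \<xi> = space_ip f (chi \<xi>)"
  by (simp add: fourier_def space_ip_def chi_commute[of _ \<xi>])

lemma fourier_chi: "fourier (chi m) \<xi> = (if \<xi> = m then 1 else 0)"
  by (auto simp: fourier_def chi_commute[of m] sum_chi_cnj)

text \<open>Fourier inversion: every function is a combination of characters.\<close>

lemma fourier_expansion:
  fixes f :: "'q::prime_card mod_ring ^ 'd \<Rightarrow> complex"
  shows "f = (\<Sum>\<xi>\<in>UNIV. cscale (fourier f \<xi>) (chi \<xi>))"
proof
  fix x
  let ?N = "of_nat (CARD('q) ^ CARD('d)) :: complex"
  have eval: "(\<Sum>\<xi>\<in>S. cscale (fourier f \<xi>) (chi \<xi>)) x = (\<Sum>\<xi>\<in>S. fourier f \<xi> * chi \<xi> x)" for S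
    by (induction S rule: infinite_finite_induct) (simp_all add: cscale_def)
  have "(\<Sum>\<xi>\<in>UNIV. fourier f \<xi> * chi \<xi> x)
      = (\<Sum>\<xi>\<in>UNIV. \<Sum>m\<in>UNIV. f m / ?N * (chi \<xi> x * cnj (chi \<xi> m)))"
    unfolding fourier_def sum_divide_distrib sum_distrib_right
    by (simp add: chi_commute[of _ "_ :: 'q mod_ring ^ 'd"] mult_ac)
  also have "\<dots> = (\<Sum>m\<in>UNIV. f m / ?N * (\<Sum>\<xi>\<in>UNIV. chi \<xi> x * cnj (chi \<xi> m)))"
    by (subst sum.swap) (simp only: sum_distrib_left)
  also have "\<dots> = (\<Sum>m\<in>UNIV. if m = x then f x else 0)"
    by (intro sum.cong) (auto simp: sum_chi_cnj)
  finally show "f x = (\<Sum>\<xi>\<in>UNIV. cscale (fourier f \<xi>) (chi \<xi>)) x"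
    by (simp add: eval)
qed

lemma plancherel: "space_ip f g = freq_ip (fourier f) (fourier g)"
proof -
  have "space_ip f g = (\<Sum>\<xi>\<in>UNIV. fourier f \<xi> * space_ip (chi \<xi>) g)"
    by (subst (1) fourier_expansion[of f]) (rule space.ip_sum_left)
  then show ?thesis
    by (simp add: freq_ip_def fourier_eq_space_ip space.ip_cnj)
qed

lemma fourier_sum_chi:
  "fourier (\<Sum>\<xi>\<in>UNIV. cscale (c \<xi>) (chi \<xi>)) = c"
proof
  fix \<eta>
  have "fourier (\<Sum>\<xi>\<in>UNIV. cscale (c \<xi>) (chi \<xi>)) \<eta> = (\<Sum>\<xi>\<in>UNIV. c \<xi> * fourier (chi \<xi>) \<eta>)"
    by (simp only: fourier_eq_space_ip space.ip_sum_left)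
  also have "\<dots> = c \<eta>"
    by (simp add: fourier_chi if_distrib cong: if_cong)
  finally show "fourier (\<Sum>\<xi>\<in>UNIV. cscale (c \<xi>) (chi \<xi>)) \<eta> = c \<eta>" .
qed

lemma energy_fourier: "Re (space_ip f f) = (\<Sum>\<xi>\<in>UNIV. (cmod (fourier f \<xi>))\<^sup>2)"
  by (simp add: plancherel freq_ip_def complex_norm_square[symmetric] flip: of_real_power)

lemma subspace_PW: "cfun.subspace (PW F)"
  by (auto simp: cfun.subspace_def PW_def fourier_eq_space_ip space.ip_zero space.ip_add
      space.ip_scale)

section \<open>Wavelet coefficients\<close>

(* Products with a transpose stay in the form in which they index the dilated frequencies. *)
declare transpose_matrix_vector [simp del]

text \<open>
  Translation by \<open>l\<close> multiplies the character \<open>\<chi>\<^sub>m\<close> by the conjugate of \<open>\<chi>\<^sub>m(l) = \<chi>\<^sub>l(m)\<close>, and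
  dilation by \<open>a\<close> moves its frequency to \<open>a\<^sup>t m\<close>.
\<close>

lemma wavelet_expansion:
  "wavelet_system (wavelet_of F E) (a, l) =
    (\<Sum>m\<in>F. cscale (cnj (chi l m) / complex_of_real (sqrt (real (card E)))) (chi (transpose a *v m)))"
proof
  fix x
  let ?s = "complex_of_real (sqrt (real (card E)))"
  have eval: "(\<Sum>m\<in>S. cscale (cnj (chi l m) / ?s) (chi (transpose a *v m))) x =
      (\<Sum>m\<in>S. cnj (chi l m) / ?s * chi (transpose a *v m) x)" for S
    by (induction S rule: infinite_finite_induct) (simp_all add: cscale_def)
  have "wavelet_system (wavelet_of F E) (a, l) x = (\<Sum>m\<in>F. chi m (a *v x - l)) / ?s"
    by (simp add: wavelet_system_def dilate_def translate_def wavelet_of_def inv_fourier_def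
        sum.If_cases indicator_def if_distrib[of "\<lambda>c. c * _"] cong: if_cong)
  also have "\<dots> = (\<Sum>m\<in>F. cnj (chi l m) / ?s * chi (transpose a *v m) x)"
    by (simp add: chi_diff chi_transpose sum_divide_distrib chi_commute[of l] mult_ac)
  finally show "wavelet_system (wavelet_of F E) (a, l) x =
      (\<Sum>m\<in>F. cscale (cnj (chi l m) / ?s) (chi (transpose a *v m))) x"
    by (simp add: eval)
qed

lemma wavelet_coefficient:
  "space_ip f (wavelet_system (wavelet_of F E) (a, l)) =
    (\<Sum>m\<in>F. fourier f (transpose a *v m) * chi l m) / complex_of_real (sqrt (real (card E)))"
  unfolding wavelet_expansion space.ip_sum_right fourier_eq_space_ip sum_divide_distrib
  by (intro sum.cong) simp_all

lemma wavelet_coefficient_energy: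
  "(cmod (space_ip f (wavelet_system (wavelet_of F E) (a, l))))\<^sup>2 =
    (cmod (\<Sum>m\<in>F. fourier f (transpose a *v m) * chi l m))\<^sup>2 / real (card E)"
  by (simp add: wavelet_coefficient norm_divide power_divide)

lemma inj_transpose_mult:
  assumes "a \<in> Aut_mat"
  shows "inj ((*v) (transpose a))"
proof -
  obtain b where "a ** b = mat 1"
    using assms unfolding Aut_mat_def invertible_def by auto
  then have b: "transpose b ** transpose a = mat 1"
    by (simp only: matrix_transpose_mul[symmetric] transpose_mat)
  show ?thesis
    by (rule inj_on_inverseI[of _ "(*v) (transpose b)"]) (simp add: matrix_vector_mul_assoc b)
qed

lemma fourier_wavelet:
  assumes "a \<in> Aut_mat"
  shows "fourier (wavelet_system (wavelet_of F E) (a, l)) (transpose a *v m) =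
    (if m \<in> F then cnj (chi l m) / complex_of_real (sqrt (real (card E))) else 0)"
proof -
  let ?s = "complex_of_real (sqrt (real (card E)))"
  have eq: "transpose a *v m = transpose a *v n \<longleftrightarrow> n = m" for n
    using inj_transpose_mult[OF assms] by (auto dest: injD)
  have "fourier (wavelet_system (wavelet_of F E) (a, l)) (transpose a *v m) =
      (\<Sum>n\<in>F. cnj (chi l n) / ?s * fourier (chi (transpose a *v n)) (transpose a *v m))"
    by (simp only: wavelet_expansion fourier_eq_space_ip space.ip_sum_left)
  also have "\<dots> = (\<Sum>n\<in>F. if n = m then cnj (chi l m) / ?s else 0)"
    by (intro sum.cong) (auto simp: fourier_chi eq)
  also have "\<dots> = (if m \<in> F then cnj (chi l m) / ?s else 0)"
    by (simp add: sum.delta)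
  finally show ?thesis .
qed

text \<open>
  Every \<open>a\<^sup>t\<close> fixes the frequency \<open>0\<close>, so the Fourier transform of a wavelet at \<open>0\<close> only sees
  whether \<open>0\<close> lies in \<open>F\<close>.
\<close>

lemma wavelet_in_PW_iff:
  assumes "a \<in> Aut_mat" "E \<noteq> {}"
  shows "wavelet_system (wavelet_of F E) (a, l) \<in> PW (UNIV - {0}) \<longleftrightarrow> 0 \<notin> F"
proof -
  have "fourier (wavelet_system (wavelet_of F E) (a, l)) 0 =
      (if 0 \<in> F then 1 / complex_of_real (sqrt (real (card E))) else 0)"
    using fourier_wavelet[OF assms(1), of F E l 0] by (simp add: chi_zero)
  then show ?thesis
    using assms(2) by (simp add: PW_def)
qed

lemma wavelet_norm:
  assumes "a \<in> Aut_mat" "E \<noteq> {}"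
  shows "space_ip (wavelet_system (wavelet_of E E) (a, l)) (wavelet_system (wavelet_of E E) (a, l)) = 1"
proof -
  let ?s = "complex_of_real (sqrt (real (card E)))"
  have s2: "?s * ?s = of_nat (card E)"
    by (simp flip: of_real_mult)
  have "(\<Sum>m\<in>E. fourier (wavelet_system (wavelet_of E E) (a, l)) (transpose a *v m) * chi l m) =
      (\<Sum>m\<in>E. 1 / ?s)"
    using assms by (intro sum.cong) (simp_all add: fourier_wavelet chi_cnj_self mult.commute)
  then show ?thesis
    using assms(2) by (simp add: wavelet_coefficient s2)
qed

text \<open>
  A wavelet coefficient sums \<open>h \<chi>\<^sub>l\<close>, an inner product conjugates \<open>\<chi>\<^sub>l\<close>.  Conjugating \<open>h\<close> as well
  reconciles the two, and moduli do not notice.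
\<close>

lemma freq_ip_chi_on:
  fixes F E :: "('q::prime_card mod_ring ^ 'd) set"
  assumes "F \<subseteq> E"
  shows "freq_ip (\<lambda>m. if m \<in> F then cnj (h m) else 0) (chi_on E l) = cnj (\<Sum>m\<in>F. h m * chi l m)"
proof -
  have "freq_ip (\<lambda>m. if m \<in> F then cnj (h m) else 0) (chi_on E l) =
      (\<Sum>m\<in>UNIV. if m \<in> F then cnj (h m * chi l m) else 0)"
    unfolding freq_ip_def chi_on_def using assms by (intro sum.cong) auto
  then show ?thesis
    by (simp add: sum.If_cases)
qed

lemma freq_energy:
  fixes F :: "('q::prime_card mod_ring ^ 'd) set"
  shows "Re (freq_ip (\<lambda>m. if m \<in> F then cnj (h m) else 0) (\<lambda>m. if m \<in> F then cnj (h m) else 0)) =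
    (\<Sum>m\<in>F. (cmod (h m))\<^sup>2)"
proof -
  have "freq_ip (\<lambda>m. if m \<in> F then cnj (h m) else 0) (\<lambda>m. if m \<in> F then cnj (h m) else 0) =
      (\<Sum>m\<in>UNIV. if m \<in> F then of_real ((cmod (h m))\<^sup>2) else 0)"
    unfolding freq_ip_def
    by (intro sum.cong) (simp_all add: complex_norm_square mult.commute del: of_real_power)
  then show ?thesis
    by (simp add: sum.If_cases)
qed

section \<open>From spectra and tilings to Parseval wavelets\<close>

lemma spectral_pair_tight_frame:
  fixes E L :: "('q::prime_card mod_ring ^ 'd) set"
  assumes "spectral_pair E L" "E \<noteq> {}"
  shows "tight_frame freq_ip (L2 E) (real (card E)) L (chi_on E)"
proof (rule freq.orthogonal_basis_tight_frame)
  show "orthogonal_basis freq_ip (L2 E) L (chi_on E)"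
    using assms(1) by (simp add: spectral_pair_def)
  show "freq_ip (chi_on E l) (chi_on E l) = of_real (real (card E))" for l
  proof -
    have "freq_ip (chi_on E l) (chi_on E l) = (\<Sum>m\<in>UNIV. if m \<in> E then 1 else 0)"
      unfolding freq_ip_def chi_on_def by (intro sum.cong) (auto simp: chi_cnj_self)
    then show ?thesis
      by (simp add: sum.If_cases)
  qed
  show "real (card E) > 0"
    using assms(2) by (simp add: card_gt_0_iff)
qed

lemma sum_mult_tiling:
  fixes G Y :: "('q::prime_card mod_ring ^ 'd) set" and h :: "'q mod_ring ^ 'd \<Rightarrow> real"
  assumes "mult_tiling Y G (transpose ` A)" "A \<subseteq> Aut_mat"
  shows "(\<Sum>a\<in>A. \<Sum>m\<in>G. h (transpose a *v m)) = sum h Y"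
proof -
  have "(\<Sum>a\<in>A. \<Sum>m\<in>G. h (transpose a *v m)) = (\<Sum>a\<in>A. \<Sum>\<xi>\<in>(*v) (transpose a) ` G. h \<xi>)"
  proof (rule sum.cong[OF refl])
    fix a assume "a \<in> A"
    then have "inj_on ((*v) (transpose a)) G"
      using assms(2) inj_transpose_mult inj_on_subset by blast
    then show "(\<Sum>m\<in>G. h (transpose a *v m)) = (\<Sum>\<xi>\<in>(*v) (transpose a) ` G. h \<xi>)"
      by (simp add: sum.reindex)
  qed
  also have "\<dots> = (\<Sum>\<alpha>\<in>transpose ` A. \<Sum>\<xi>\<in>(*v) \<alpha> ` G. h \<xi>)"
    by (simp add: sum.reindex inj_on_def)
  also have "\<dots> = sum h (\<Union>\<alpha>\<in>transpose ` A. (*v) \<alpha> ` G)"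
    using assms(1)
    by (intro sum.UNION_disjoint[symmetric]) (auto simp: mult_tiling_def disjoint_family_on_def)
  finally show ?thesis
    using assms(1) by (simp add: mult_tiling_def)
qed

text \<open>
  The removal of \<open>0\<close> from \<open>E\<close> is harmless: functions on \<open>E - {0}\<close> are functions on \<open>E\<close>, and the
  tight frame identity of \<open>L2 E\<close>, with bound \<open>\<sharp>E\<close>, is only evaluated at those.
\<close>

lemma spectral_tiling_parseval:
  fixes E L :: "('q::prime_card mod_ring ^ 'd) set"
  assumes A: "A \<subseteq> Aut_mat" and E: "E \<noteq> {}" and spec: "spectral_pair E L"
    and tiling: "mult_tiling (UNIV - {0}) (E - {0}) (transpose ` A)"
  shows "parseval_frame space_ip (PW (UNIV - {0})) (A \<times> L) (wavelet_system (wavelet_of (E - {0}) E))"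
proof -
  let ?w = "wavelet_system (wavelet_of (E - {0}) E)"
  have piece: "(\<Sum>l\<in>L. (cmod (\<Sum>m\<in>E - {0}. h m * chi l m))\<^sup>2) =
      card E * (\<Sum>m\<in>E - {0}. (cmod (h m))\<^sup>2)" for h
  proof -
    let ?g = "\<lambda>m. if m \<in> E - {0} then cnj (h m) else 0"
    have "?g \<in> L2 E"
      by (auto simp: L2_def)
    then have "(\<Sum>l\<in>L. (cmod (freq_ip ?g (chi_on E l)))\<^sup>2) = card E * Re (freq_ip ?g ?g)"
      using spectral_pair_tight_frame[OF spec E] unfolding tight_frame_def by blast
    moreover have "E - {0} \<subseteq> E" by auto
    ultimately show ?thesis
      by (simp only: freq_ip_chi_on freq_energy complex_mod_cnj)
  qed
  have "(\<Sum>k\<in>A \<times> L. (cmod (space_ip f (?w k)))\<^sup>2) = Re (space_ip f f)"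
    if f: "f \<in> PW (UNIV - {0})" for f
  proof -
    have "(\<Sum>k\<in>A \<times> L. (cmod (space_ip f (?w k)))\<^sup>2) =
        (\<Sum>a\<in>A. \<Sum>l\<in>L. (cmod (space_ip f (?w (a, l))))\<^sup>2)"
      by (simp add: sum.cartesian_product case_prod_unfold)
    also have "\<dots> = (\<Sum>a\<in>A. \<Sum>m\<in>E - {0}. (cmod (fourier f (transpose a *v m)))\<^sup>2)"
      using E by (simp add: wavelet_coefficient_energy sum_divide_distrib[symmetric] piece)
    also have "\<dots> = (\<Sum>\<xi>\<in>UNIV - {0}. (cmod (fourier f \<xi>))\<^sup>2)"
      by (rule sum_mult_tiling[OF tiling A])
    also have "\<dots> = (\<Sum>\<xi>\<in>UNIV. (cmod (fourier f \<xi>))\<^sup>2)"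
      using f by (intro sum.mono_neutral_left) (auto simp: PW_def)
    finally show ?thesis
      by (simp add: energy_fourier)
  qed
  moreover have "\<forall>k\<in>A \<times> L. ?w k \<in> PW (UNIV - {0})"
    using A E wavelet_in_PW_iff by blast
  ultimately show ?thesis
    by (simp add: parseval_frame_def tight_frame_def)
qed

section \<open>From Parseval wavelets to covers and tight frame spectral pairs\<close>

text \<open>
  The test function is \<open>\<chi>\<^sub>\<xi>\<close>, which has norm one: some wavelet coefficient of it must be nonzero,
  and its Fourier transform is the point mass at \<open>\<xi>\<close>.
\<close>

lemma parseval_covers:
  fixes E L :: "('q::prime_card mod_ring ^ 'd) set"
  assumes pars: "parseval_frame space_ip (PW (UNIV - {0})) (A \<times> L) (wavelet_system (wavelet_of E E))"
    and "\<xi> \<noteq> 0"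
  obtains a where "a \<in> A" "L \<noteq> {}" "\<xi> \<in> (*v) (transpose a) ` E"
proof -
  let ?w = "wavelet_system (wavelet_of E E)"
  have "chi \<xi> \<in> PW (UNIV - {0})"
    using \<open>\<xi> \<noteq> 0\<close> by (auto simp: PW_def fourier_chi)
  then have "(\<Sum>k\<in>A \<times> L. (cmod (space_ip (chi \<xi>) (?w k)))\<^sup>2) = Re (space_ip (chi \<xi>) (chi \<xi>))"
    using pars by (simp add: parseval_frame_def tight_frame_def)
  also have "\<dots> = 1"
    by (simp add: fourier_chi flip: fourier_eq_space_ip)
  finally have "(\<Sum>k\<in>A \<times> L. (cmod (space_ip (chi \<xi>) (?w k)))\<^sup>2) \<noteq> 0"
    by simp
  then obtain k where "k \<in> A \<times> L" "(cmod (space_ip (chi \<xi>) (?w k)))\<^sup>2 \<noteq> 0"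
    by (rule sum.not_neutral_contains_not_neutral)
  then obtain a l where al: "a \<in> A" "l \<in> L" and "space_ip (chi \<xi>) (?w (a, l)) \<noteq> 0"
    by auto
  then have "(\<Sum>m\<in>E. fourier (chi \<xi>) (transpose a *v m) * chi l m) \<noteq> 0"
    by (auto simp: wavelet_coefficient)
  then obtain m where "m \<in> E" "fourier (chi \<xi>) (transpose a *v m) * chi l m \<noteq> 0"
    by (rule sum.not_neutral_contains_not_neutral)
  then show ?thesis
    using al that by (auto simp: fourier_chi split: if_splits)
qed

text \<open>
  A function \<open>g\<close> on \<open>E\<close> is conjugated, moved to \<open>a\<^sup>t E\<close> for one fixed \<open>a\<close>, and read as the Fourier
  transform of some \<open>f\<close>.  By disjointness only the wavelets with dilation \<open>a\<close> have nonzero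
  coefficients, and up to the factor \<open>1 / \<sharp>E\<close> their energies are those of the frame
  coefficients of \<open>g\<close>.  Since \<open>0 \<notin> E\<close>, such an \<open>f\<close> lies in the Paley-Wiener space.
\<close>

lemma parseval_disjoint_tight_frame:
  fixes E L :: "('q::prime_card mod_ring ^ 'd) set" and A :: "('q mod_ring ^ 'd ^ 'd) set"
  assumes A: "A \<subseteq> Aut_mat" and a: "a \<in> A" and E: "E \<noteq> {}" and zero: "0 \<notin> E"
    and pars: "parseval_frame space_ip (PW (UNIV - {0})) (A \<times> L) (wavelet_system (wavelet_of E E))"
    and disj: "disjoint_family_on (\<lambda>a. (*v) (transpose a) ` E) A"
  shows "tight_frame freq_ip (L2 E) (real (card E)) L (chi_on E)"
proof -
  let ?w = "wavelet_system (wavelet_of E E)" and ?T = "(*v) (transpose a)"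
  have inj: "inj ?T"
    using A a by (auto intro: inj_transpose_mult)
  have "(\<Sum>l\<in>L. (cmod (freq_ip g (chi_on E l)))\<^sup>2) = card E * Re (freq_ip g g)"
    if g: "g \<in> L2 E" for g
  proof -
    define h where "h = (\<lambda>m. cnj (g m))"
    have gh: "g = (\<lambda>m. if m \<in> E then cnj (h m) else 0)"
      using g by (auto simp: h_def L2_def)
    define c where "c = (\<lambda>\<xi>. if \<xi> \<in> ?T ` E then h (inv_into UNIV ?T \<xi>) else 0)"
    define f where "f = (\<Sum>\<xi>\<in>UNIV. cscale (c \<xi>) (chi \<xi>))"
    have four: "fourier f = c"
      unfolding f_def by (rule fourier_sum_chi)
    have c_a: "c (transpose a *v m) = h m" if "m \<in> E" for m
      using that inj by (auto simp: c_def)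
    have c_b: "c (transpose b *v m) = 0" if "b \<in> A" "b \<noteq> a" "m \<in> E" for b m
    proof -
      have "transpose b *v m \<notin> ?T ` E"
        using disjoint_family_onD[OF disj that(1) a that(2)] that(3) by blast
      then show ?thesis by (simp add: c_def)
    qed
    have "c 0 = 0"
    proof -
      have "0 \<notin> ?T ` E"
      proof
        assume "0 \<in> ?T ` E"
        then obtain m where "m \<in> E" "?T m = ?T 0" by auto
        then show False using injD[OF inj] zero by blast
      qed
      then show ?thesis by (simp add: c_def)
    qed
    then have "f \<in> PW (UNIV - {0})"
      by (simp add: PW_def four)
    then have "Re (space_ip f f) = (\<Sum>k\<in>A \<times> L. (cmod (space_ip f (?w k)))\<^sup>2)"
      using pars by (simp add: parseval_frame_def tight_frame_def)
    also have "\<dots> = (\<Sum>b\<in>A. \<Sum>l\<in>L. (cmod (space_ip f (?w (b, l))))\<^sup>2)"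
      by (simp add: sum.cartesian_product case_prod_unfold)
    also have "\<dots> = (\<Sum>b\<in>A. \<Sum>l\<in>L. (cmod (\<Sum>m\<in>E. c (transpose b *v m) * chi l m))\<^sup>2 / card E)"
      by (simp only: wavelet_coefficient_energy four)
    also have "\<dots> = (\<Sum>b\<in>A. if b = a then \<Sum>l\<in>L. (cmod (\<Sum>m\<in>E. h m * chi l m))\<^sup>2 / card E else 0)"
      by (intro sum.cong refl) (simp_all add: c_a c_b)
    also have "\<dots> = (\<Sum>l\<in>L. (cmod (\<Sum>m\<in>E. h m * chi l m))\<^sup>2) / card E"
      using a by (simp add: sum_divide_distrib)
    finally have lhs: "(\<Sum>l\<in>L. (cmod (\<Sum>m\<in>E. h m * chi l m))\<^sup>2) = card E * Re (space_ip f f)"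
      using E by simp
    have "Re (space_ip f f) = (\<Sum>\<xi>\<in>?T ` E. (cmod (c \<xi>))\<^sup>2)"
      unfolding energy_fourier four by (rule sum.mono_neutral_right) (auto simp: c_def)
    also have "\<dots> = (\<Sum>m\<in>E. (cmod (h m))\<^sup>2)"
      using inj by (subst sum.reindex) (auto intro: inj_on_subset simp: c_a)
    finally show ?thesis
      using lhs unfolding gh by (simp only: freq_ip_chi_on[OF subset_refl] freq_energy complex_mod_cnj)
  qed
  moreover have "\<forall>l\<in>L. chi_on E l \<in> L2 E"
    by (simp add: chi_on_def L2_def)
  ultimately show ?thesis
    using E by (simp add: tight_frame_def card_gt_0_iff)
qed

section \<open>Wavelet sets over prime fields\<close>

theorem theorem2p9:
  fixes E Y :: "('q::prime_card mod_ring ^ 'd) set"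
  assumes q_odd: "odd CARD('q)"
    and Y_def: "Y = UNIV - {0}"
    and E_gt: "1 < card E"
    and E_lt: "card E < CARD('q) ^ CARD('d)"
  shows
    "(\<forall>A L. A \<subseteq> Aut_mat \<and> spectral_pair E L \<and> E - {0} \<noteq> {} \<and> mult_tiling Y (E - {0}) (transpose ` A) \<longrightarrow>
        parseval_frame space_ip (PW Y) (A \<times> L) (wavelet_system (wavelet_of (E - {0}) E)) \<and>
        (E = E - {0} \<longrightarrow>
          orthonormal_basis space_ip (PW Y) (A \<times> L) (wavelet_system (wavelet_of (E - {0}) E)))) \<and>
     (\<forall>A L. A \<subseteq> Aut_mat \<and>
        parseval_frame space_ip (PW Y) (A \<times> L) (wavelet_system (wavelet_of E E)) \<longrightarrow>
        Y = (\<Union>a\<in>A. (*v) (transpose a) ` (E - {0})) \<and>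
        (disjoint_family_on (\<lambda>a. (*v) (transpose a) ` (E - {0})) A \<longrightarrow>
          tight_frame_spectral_pair (E - {0}) L))"
proof (intro conjI allI impI; (elim conjE)?)
  have E: "E \<noteq> {}"
    using E_gt by auto
  {
    fix A :: "('q mod_ring ^ 'd ^ 'd) set" and L :: "('q mod_ring ^ 'd) set"
    assume A: "A \<subseteq> Aut_mat" and spec: "spectral_pair E L"
      and tiling: "mult_tiling Y (E - {0}) (transpose ` A)"
    show frame: "parseval_frame space_ip (PW Y) (A \<times> L) (wavelet_system (wavelet_of (E - {0}) E))"
      using spectral_tiling_parseval[OF A E spec] tiling by (simp add: Y_def)
    assume E0: "E = E - {0}"
    have "space_ip (wavelet_system (wavelet_of (E - {0}) E) k)
        (wavelet_system (wavelet_of (E - {0}) E) k) = 1" if k: "k \<in> A \<times> L" for k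
    proof -
      obtain a l where al: "k = (a, l)" "a \<in> Aut_mat"
        using k A by blast
      show ?thesis
        unfolding al(1) E0[symmetric] by (rule wavelet_norm[OF al(2) E])
    qed
    with frame show "orthonormal_basis space_ip (PW Y) (A \<times> L) (wavelet_system (wavelet_of (E - {0}) E))"
      by (intro space.parseval_unit_orthonormal_basis subspace_PW)
  }
  {
    fix A :: "('q mod_ring ^ 'd ^ 'd) set" and L :: "('q mod_ring ^ 'd) set"
    assume A: "A \<subseteq> Aut_mat"
      and "parseval_frame space_ip (PW Y) (A \<times> L) (wavelet_system (wavelet_of E E))"
    then have pars: "parseval_frame space_ip (PW (UNIV - {0})) (A \<times> L) (wavelet_system (wavelet_of E E))"
      by (simp add: Y_def)
    obtain a l where a: "a \<in> A" and l: "l \<in> L"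
      by (rule parseval_covers[OF pars one_neq_zero]) blast
    have "wavelet_system (wavelet_of E E) (a, l) \<in> PW (UNIV - {0})"
      using pars a l by (simp add: parseval_frame_def tight_frame_def)
    then have zero: "0 \<notin> E"
      using A a wavelet_in_PW_iff[OF _ E] by (metis subsetD)
    then have E0: "E - {0} = E" by simp
    show "Y = (\<Union>a\<in>A. (*v) (transpose a) ` (E - {0}))"
    proof
      show "Y \<subseteq> (\<Union>a\<in>A. (*v) (transpose a) ` (E - {0}))"
      proof
        fix \<xi> assume "\<xi> \<in> Y"
        then have "\<xi> \<noteq> 0"
          by (simp add: Y_def)
        with pars obtain b where "b \<in> A" "\<xi> \<in> (*v) (transpose b) ` E"
          by (rule parseval_covers)
        then show "\<xi> \<in> (\<Union>a\<in>A. (*v) (transpose a) ` (E - {0}))"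
          unfolding E0 by (rule UN_I)
      qed
      have "transpose b *v m \<noteq> 0" if "b \<in> A" "m \<in> E" for b m
      proof
        assume "transpose b *v m = 0"
        then have "transpose b *v m = transpose b *v 0"
          by simp
        moreover have "inj ((*v) (transpose b))"
          using that(1) A by (intro inj_transpose_mult) (rule subsetD)
        ultimately have "m = 0"
          by (rule injD[rotated])
        then show False
          using that(2) zero by simp
      qed
      then show "(\<Union>a\<in>A. (*v) (transpose a) ` (E - {0})) \<subseteq> Y"
        unfolding Y_def E0 by fast
    qed
    assume "disjoint_family_on (\<lambda>a. (*v) (transpose a) ` (E - {0})) A"
    then show "tight_frame_spectral_pair (E - {0}) L"
      using parseval_disjoint_tight_frame[OF A a E zero pars]
      unfolding tight_frame_spectral_pair_def E0 by blast
  }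
qed

end
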